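(* For all $m\in\mathbb{N}\setminus\{0,1\}$, $\mathscr{T}_{m}=\mathscr{C}(m,\{(1,1),(2,2),\ldots,(m-1,m-1)\})$.
   Context: $\mathbb{N}$ is the set of non-negative integers. A numerical semigroup is a subset $S\subseteq\mathbb{N}$ closed under addition, with $0\in S$ and $\mathbb{N}\setminus S$ finite. The multiplicity $\mathrm{m}(S)$ is the least positive element of $S$. $\mathscr{S}_m$ is the set of numerical semigroups with multiplicity $m$. $x \bmod m$ denotes the remainder after division of $x$ by $m$. For an integer $m\ge 2$ and a finite set $A\subseteq\bigcup_{k\geq 2}\{1,\ldots,m-1\}^k$, $\mathscr{C}(m,A)$ is the set of all $S\in\mathscr{S}_m$ such that for every $k\ge 2$ and every $(s_1,\ldots,s_k)\in S^k$ with $(s_1\bmod m,\ldots,s_k\bmod m)\in A$ one has $s_1+\cdots+s_k-m\in S$. A numerical semigroup $S$ is thin if $2x-\mathrm{m}(S)\in S$ for all $x\in S\setminus\{0\}$. $\mathscr{T}_m$ is the set of all thin numerical semigroups with multiplicity $m$. *)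

theory Defs
  imports Main
begin

definition numerical_semigroup :: "nat set \<Rightarrow> bool" where
  "numerical_semigroup S \<longleftrightarrow>
     0 \<in> S \<and> (\<forall>x\<in>S. \<forall>y\<in>S. x + y \<in> S) \<and> finite (UNIV - S)"

(* A numerical semigroup is cofinite, so it has a positive element and LEAST is meaningful. *)
definition semigroup_mult :: "nat set \<Rightarrow> nat" where
  "semigroup_mult S = (LEAST x. x \<in> S \<and> 0 < x)"

definition semigroups_of_mult :: "nat \<Rightarrow> nat set set" where
  "semigroups_of_mult m = {S. numerical_semigroup S \<and> semigroup_mult S = m}"

(* The class C(m, A). A k-tuple is a list of length k. The definition is meant for m \<ge> 2 and
   finite A \<subseteq> {xs. 2 \<le> length xs \<and> set xs \<subseteq> {1..m - 1}}. For such A the subtraction never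
   truncates: every s_i has a nonzero residue, so it is a positive element of S and s_i \<ge> m. *)
definition pattern_class :: "nat \<Rightarrow> nat list set \<Rightarrow> nat set set" where
  "pattern_class m A =
     {S \<in> semigroups_of_mult m.
        \<forall>k\<ge>2. \<forall>s. length s = k \<and> set s \<subseteq> S \<and> map (\<lambda>x. x mod m) s \<in> A
          \<longrightarrow> sum_list s - m \<in> S}"

(* No truncation here either: a nonzero x in S satisfies x \<ge> semigroup_mult S. *)
definition thin :: "nat set \<Rightarrow> bool" where
  "thin S \<longleftrightarrow> numerical_semigroup S \<and> (\<forall>x\<in>S - {0}. 2 * x - semigroup_mult S \<in> S)"

definition thin_semigroups_of_mult :: "nat \<Rightarrow> nat set set" where
  "thin_semigroups_of_mult m = {S \<in> semigroups_of_mult m. thin S}"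

end

theory Submission
  imports Defs
begin

text \<open>Thinness covers only pairs (x, x), whereas the patterns (i, i) cover all pairs a, b in S
  with a common nonzero residue mod m. The gap closes because congruent elements differ by a
  multiple of m, which lies in S: if a \<le> b and b = a + m q, then a + b - m = (2 a - m) + m q is
  a sum of two elements of S (\<open>thin_add_diff\<close>). Conversely, the pair (x, x) yields 2 x
  - m in S when m does not divide x. When x = m q is nonzero, 2 x - m = m (2 q - 1) is a multiple of
  m and so lies in S in any case.\<close>

lemma semigroup_mult_in:
  assumes "numerical_semigroup S"
  shows "semigroup_mult S \<in> S" "0 < semigroup_mult S"
proof -
  have "infinite S"
    using assms unfolding numerical_semigroup_def
    by (metis Diff_infinite_finite infinite_UNIV_nat)
  then have "\<not> S \<subseteq> {0}"
    using finite_subset by blast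
  then obtain x where "x \<in> S" "x \<noteq> 0"
    by blast
  then have "x \<in> S \<and> 0 < x"
    by simp
  then have "semigroup_mult S \<in> S \<and> 0 < semigroup_mult S"
    unfolding semigroup_mult_def by (rule LeastI)
  then show "semigroup_mult S \<in> S" "0 < semigroup_mult S" by auto
qed

lemma semigroup_mult_le:
  assumes "x \<in> S" "0 < x"
  shows "semigroup_mult S \<le> x"
  unfolding semigroup_mult_def using assms by (intro Least_le) simp

lemma numerical_semigroup_add:
  "numerical_semigroup S \<Longrightarrow> x \<in> S \<Longrightarrow> y \<in> S \<Longrightarrow> x + y \<in> S"
  by (simp add: numerical_semigroup_def)

lemma numerical_semigroup_multiple:
  assumes "numerical_semigroup S" "x \<in> S"
  shows "x * n \<in> S"
  using assms by (induction n) (auto simp: numerical_semigroup_def)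

text \<open>Replacing a by a larger congruent b raises the sum by a multiple of the multiplicity, so
  the thin condition at the smaller element a suffices.\<close>

lemma thin_add_diff:
  assumes "thin S" "a \<in> S" "b \<in> S" "0 < a" "a \<le> b"
    and cong: "a mod semigroup_mult S = b mod semigroup_mult S"
  shows "a + b - semigroup_mult S \<in> S"
proof -
  let ?m = "semigroup_mult S"
  have S: "numerical_semigroup S" and "2 * a - ?m \<in> S"
    using assms by (auto simp: thin_def)
  obtain q where q: "b = a + ?m * q"
    using \<open>a \<le> b\<close> cong by (metis mod_eq_nat1E[of b _ a])
  have "(2 * a - ?m) + ?m * q \<in> S"
    using S \<open>2 * a - ?m \<in> S\<close> semigroup_mult_in(1)[OF S]
    by (intro numerical_semigroup_add numerical_semigroup_multiple)
  \<comment> \<open>This rules out truncation in \<open>2 * a - ?m\<close>, so that adding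
    \<open>?m * q\<close> gives exactly \<open>a + b - ?m\<close>.\<close>
  moreover have "?m \<le> a"
    using assms by (intro semigroup_mult_le)
  ultimately show ?thesis
    by (simp add: q mult_2 add.assoc)
qed

theorem proposition4p3:
  fixes m :: nat
  assumes "m \<notin> {0, 1}"
  shows "thin_semigroups_of_mult m = pattern_class m {[i, i] | i. i \<in> {1..m - 1}}"
proof (intro set_eqI iffI)
  fix S assume "S \<in> thin_semigroups_of_mult m"
  then have S: "S \<in> semigroups_of_mult m" and "thin S" and m: "semigroup_mult S = m"
    by (auto simp: thin_semigroups_of_mult_def semigroups_of_mult_def)
  have "sum_list s - m \<in> S"
    if "set s \<subseteq> S" and s: "map (\<lambda>x. x mod m) s \<in> {[i, i] | i. i \<in> {1..m - 1}}" for s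
  proof -
    obtain a b where ab: "s = [a, b]" "a mod m = b mod m" "0 < a mod m"
      using s by auto
    \<comment> \<open>Either entry may be the smaller one, and \<open>thin_add_diff\<close> needs
      the smaller one to be positive; a nonzero residue ensures this.\<close>
    moreover have "0 < a" "0 < b"
      using ab by (metis gr0I mod_0)+
    moreover have "a \<in> S" "b \<in> S"
      using that(1) ab(1) by simp_all
    ultimately have "a + b - m \<in> S"
      using thin_add_diff[OF \<open>thin S\<close>, of a b] thin_add_diff[OF \<open>thin S\<close>, of b a]
        ab(2) m linear[of a b] by (metis add.commute)
    then show ?thesis by (simp add: ab)
  qed
  with S show "S \<in> pattern_class m {[i, i] | i. i \<in> {1..m - 1}}"
    by (auto simp: pattern_class_def)
next
  fix S assume P: "S \<in> pattern_class m {[i, i] | i. i \<in> {1..m - 1}}"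
  then have S: "numerical_semigroup S" and m: "semigroup_mult S = m"
    by (auto simp: pattern_class_def semigroups_of_mult_def)
  have "2 * x - m \<in> S" if "x \<in> S" "x \<noteq> 0" for x
  proof (cases "x mod m = 0")
    case True
    then obtain q where "x = m * q" by auto
    \<comment> \<open>No pattern has residue 0, so multiples of m are treated directly. The identity
      also holds for truncated subtraction at q = 0.\<close>
    then have "2 * x - m = m * (2 * q - 1)"
      by (simp add: diff_mult_distrib2)
    then show ?thesis
      using numerical_semigroup_multiple[OF S semigroup_mult_in(1)[OF S]] m by simp
  next
    case False
    have "x mod m < m" using assms by simp
    with False have "x mod m \<in> {1..m - 1}" by auto
    \<comment> \<open>The pattern (i, i) with i = \<open>x mod m\<close> is applied to the pair (x,
      x), that is, with k = 2.\<close>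
    then have "sum_list [x, x] - m \<in> S"
      using P \<open>x \<in> S\<close> unfolding pattern_class_def
      by (elim CollectE conjE allE[of _ 2] impE allE[of _ "[x, x]"]) simp_all
    then show ?thesis by (simp add: mult_2)
  qed
  with S m show "S \<in> thin_semigroups_of_mult m"
    by (simp add: thin_semigroups_of_mult_def semigroups_of_mult_def thin_def)
qed

end
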